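(* Let $\vec{G}$ be a subcubic oriented graph of order $n$. Then ${\cal D}_2(\vec{G})$ is connected and has diameter at most $2n$.
   Context: An oriented graph is a digraph with no pair of opposite arcs $uv,vu$; it is subcubic if its underlying graph has maximum degree at most $3$. A $2$-dicolouring is a map $V\to\{1,2\}$ with no monochromatic directed cycle; ${\cal D}_2(\vec{G})$ is the graph on the $2$-dicolourings of $\vec{G}$ in which two are adjacent if they differ on exactly one vertex. *)

theory Defs
  imports "Graph_Theory.Graph_Theory" "HOL-Library.FuncSet"
begin

text \<open>
  Simple undirected graphs are symmetric loop-free digraphs, as in the Graph_Theory entry.
  The locale \<open>pair_digraph\<close> is that of finite digraphs without loops or parallel arcs.
\<close>

locale oriented_graph = pair_digraph +
  assumes no_opposite_arcs: "(u, v) \<in> parcs G \<Longrightarrow> (v, u) \<notin> parcs G"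

text \<open>
  In the symmetric digraph \<open>mk_symmetric G\<close>, the out-degree of a vertex is its degree in
  the underlying undirected graph.
\<close>

definition subcubic :: "'a pair_pre_digraph \<Rightarrow> bool" where
  "subcubic G \<longleftrightarrow> (\<forall>v \<in> pverts G. out_degree (mk_symmetric G) v \<le> 3)"

definition monochromatic :: "('a \<Rightarrow> nat) \<Rightarrow> ('a \<times> 'a) awalk \<Rightarrow> bool" where
  "monochromatic c p \<longleftrightarrow> (\<exists>i. \<forall>e \<in> set p. c (fst e) = i \<and> c (snd e) = i)"

text \<open>
  Colourings are extensional functions (undefined outside the vertex set), so that equality
  of colourings is equality on the vertices.
\<close>

definition dicolouring :: "nat \<Rightarrow> 'a pair_pre_digraph \<Rightarrow> ('a \<Rightarrow> nat) \<Rightarrow> bool" where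
  "dicolouring k G c \<longleftrightarrow>
     c \<in> pverts G \<rightarrow>\<^sub>E {1..k} \<and> \<not> (\<exists>p. pre_digraph.cycle G p \<and> monochromatic c p)"

definition dicolouring_graph :: "nat \<Rightarrow> 'a pair_pre_digraph \<Rightarrow> ('a \<Rightarrow> nat) pair_pre_digraph" where
  "dicolouring_graph k G =
     \<lparr> pverts = {c. dicolouring k G c},
       parcs = {(c, d). dicolouring k G c \<and> dicolouring k G d \<and>
                        (\<exists>!v. v \<in> pverts G \<and> c v \<noteq> d v)} \<rparr>"

lemma pair_bidirected_digraph_dicolouring_graph:
  "pair_bidirected_digraph (dicolouring_graph k G)"
proof -
  have "\<And>c d. (\<exists>!v. v \<in> pverts G \<and> c v \<noteq> d v) = (\<exists>!v. v \<in> pverts G \<and> d v \<noteq> (c v :: nat))"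
    by metis
  then show ?thesis
    by unfold_locales (auto simp: dicolouring_graph_def symmetric_def sym_def)
qed

text \<open>
  \<open>\<mu>\<close> with unit weights is the length of a shortest walk, infinite if there is no walk.
\<close>

definition diameter :: "('a, 'b) pre_digraph \<Rightarrow> ereal" where
  "diameter G = (SUP (u, v) \<in> verts G \<times> verts G. wf_digraph.\<mu> G (\<lambda>_. 1) u v)"

end

theory Submission
  imports Defs
begin

text \<open>
  Let \<open>X\<close> be the set of vertices on which \<open>\<alpha>\<close> and \<open>\<beta>\<close> differ. If some vertex of \<open>X\<close> can be given
  its final colour directly, do so: one step, and \<open>X\<close> loses a vertex. Otherwise the degree bound
  yields an arc \<open>vu\<close> with both ends in \<open>X\<close> and \<open>\<alpha> v \<noteq> \<alpha> u\<close>, and an in-neighbour \<open>x\<close> of \<open>v\<close> that can be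
  recoloured; then recolouring \<open>x\<close>, \<open>v\<close>, \<open>u\<close> and \<open>x\<close> back swaps the colours of \<open>v\<close> and \<open>u\<close>: four steps,
  and \<open>X\<close> loses two vertices. Hence the distance is at most \<open>2 |X|\<close>.
\<close>

section \<open>Cycles that appear in a relation when its pairs at one vertex change\<close>

lemma trancl_avoiding:
  assumes "r' \<subseteq> r \<union> {v} \<times> UNIV \<union> UNIV \<times> {v}"
    and "(a, b) \<in> r'\<^sup>+"
  shows "(a, b) \<in> r\<^sup>+ \<or> (a, v) \<in> r'\<^sup>* \<and> (v, b) \<in> r'\<^sup>*"
  using assms(2)
proof (induction rule: trancl_induct)
  case (base y)
  then show ?case using assms(1) by auto
next
  case (step y z)
  have "(y, z) \<in> r \<or> y = v \<or> z = v" using step.hyps assms(1) by auto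
  then show ?case
    using step by (meson rtrancl.simps trancl.trancl_into_trancl trancl_into_rtrancl)
qed

text \<open>Cut the path at its first arrival in \<open>v\<close>: every earlier pair avoids
  \<open>v\<close> and so lies in \<open>r\<close>.\<close>

lemma rtrancl_first_visit:
  assumes "r' \<subseteq> r \<union> {v} \<times> UNIV \<union> UNIV \<times> {v}"
    and "(y, v) \<in> r'\<^sup>*"
  shows "y = v \<or> (\<exists>x. (y, x) \<in> r\<^sup>* \<and> (x, v) \<in> r')"
  using assms(2)
proof (induction rule: converse_rtrancl_induct)
  case base
  then show ?case by simp
next
  case (step y z)
  have "(y, z) \<in> r \<or> y = v \<or> z = v" using step.hyps assms(1) by auto
  then show ?case
    using step by (meson converse_rtrancl_into_rtrancl rtrancl.rtrancl_refl)
qed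

text \<open>A cycle of \<open>r'\<close> cannot lie in \<open>r\<close>, so it meets
  \<open>v\<close>; follow it from \<open>v\<close> to its first return. A loop at \<open>v\<close>
  is the case \<open>x = y = v\<close>, which has to be excluded at each use.\<close>

lemma cycle_through_new_vertex:
  assumes "acyclic r" and sub: "r' \<subseteq> r \<union> {v} \<times> UNIV \<union> UNIV \<times> {v}"
    and "\<not> acyclic r'"
  shows "\<exists>x y. (x, v) \<in> r' \<and> (v, y) \<in> r' \<and> (y, x) \<in> r\<^sup>*"
proof -
  obtain a where a: "(a, a) \<in> r'\<^sup>+" using assms(3) by (auto simp: acyclic_def)
  have "(a, a) \<notin> r\<^sup>+" using assms(1) by (auto simp: acyclic_def)
  with trancl_avoiding[OF sub a] have "(a, v) \<in> r'\<^sup>*" "(v, a) \<in> r'\<^sup>*" by auto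
  with a have "(v, v) \<in> r'\<^sup>+" by (meson rtrancl_trancl_trancl trancl_rtrancl_trancl)
  then obtain y where y: "(v, y) \<in> r'" "(y, v) \<in> r'\<^sup>*" by (meson tranclD)
  show ?thesis
    using rtrancl_first_visit[OF sub y(2)] y(1) by blast
qed

text \<open>Serves to carry a monochromatic path over to a second colouring, with \<open>P\<close>
  saying that the vertex has the same colour there. As \<open>P\<close> is assumed only between
  \<open>y\<close> and \<open>x\<close>, a failure of it supplies a vertex on such a path.\<close>

lemma rtrancl_restrict_to_path:
  assumes "(y, x) \<in> r\<^sup>*"
    and "\<And>u. (y, u) \<in> r\<^sup>* \<Longrightarrow> (u, x) \<in> r\<^sup>* \<Longrightarrow> P u"
  shows "(y, x) \<in> (r \<inter> {(a, b). P a \<and> P b})\<^sup>*"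
  using assms
proof (induction rule: converse_rtrancl_induct)
  case base
  then show ?case by simp
next
  case (step y z)
  have "P y" "P z" using step.prems step.hyps
    by (meson converse_rtrancl_into_rtrancl r_into_rtrancl rtrancl.rtrancl_refl)+
  moreover have "(z, x) \<in> (r \<inter> {(a, b). P a \<and> P b})\<^sup>*"
    using step by (meson converse_rtrancl_into_rtrancl)
  ultimately show ?case using step.hyps(1) by (simp add: converse_rtrancl_into_rtrancl)
qed

section \<open>Dicolourings as colourings with acyclic colour classes\<close>

definition colour_arcs :: "'a pair_pre_digraph \<Rightarrow> ('a \<Rightarrow> nat) \<Rightarrow> nat \<Rightarrow> 'a rel" where
  "colour_arcs G c i = {(x, y) \<in> parcs G. c x = i \<and> c y = i}"

lemma (in pair_wf_digraph) awalk_imp_trancl: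
  assumes "awalk u p v" and "p \<noteq> []" and "set p \<subseteq> r"
  shows "(u, v) \<in> r\<^sup>+"
  using assms
proof (induction p arbitrary: u)
  case Nil
  then show ?case by simp
next
  case (Cons e p)
  have e: "(u, snd e) \<in> r" and w: "awalk (snd e) p v"
    using Cons.prems by (auto simp: awalk_Cons_iff)
  show ?case
  proof (cases "p = []")
    case True
    then show ?thesis using e w by (auto simp: awalk_Nil_iff)
  next
    case False
    then have "(snd e, v) \<in> r\<^sup>+" using Cons.IH[OF w] Cons.prems by simp
    then show ?thesis using e by (meson trancl_into_trancl2)
  qed
qed

lemma (in pair_wf_digraph) trancl_imp_closed_walk:
  assumes "(u, v) \<in> (parcs G)\<^sup>+"
  shows "\<exists>p. awalk u p v \<and> p \<noteq> []"
proof -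
  obtain w where w: "(u, w) \<in> parcs G" "(w, v) \<in> (parcs G)\<^sup>*" using assms by (meson tranclD)
  have "\<exists>p. awalk w p v"
    using w(2)
  proof (induction rule: converse_rtrancl_induct)
    case base
    have "v \<in> pverts G" using assms by (meson tranclD2 in_arcsD2)
    then show ?case by (auto simp: awalk_Nil_iff intro: exI[of _ "[]"])
  next
    case (step y z)
    then obtain p where "awalk z p v" by blast
    then have "awalk y ((y, z) # p) v" using step by (auto simp: awalk_Cons_iff)
    then show ?case by blast
  qed
  then obtain p where "awalk w p v" by blast
  then have "awalk u ((u, w) # p) v" using w by (auto simp: awalk_Cons_iff)
  then show ?thesis by blast
qed

text \<open>Passes from walks to relations: a monochromatic cycle puts a pair \<open>(u, u)\<close>
  into the transitive closure of a colour class, and conversely such a pair gives a closed walk,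
  which contains a cycle.\<close>

lemma (in pair_wf_digraph) dicolouring_iff:
  "dicolouring k G c \<longleftrightarrow> c \<in> pverts G \<rightarrow>\<^sub>E {1..k} \<and> (\<forall>i. acyclic (colour_arcs G c i))"
proof -
  have "(\<exists>p. cycle p \<and> monochromatic c p) \<longleftrightarrow> (\<exists>i. \<not> acyclic (colour_arcs G c i))"
  proof
    assume "\<exists>p. cycle p \<and> monochromatic c p"
    then obtain p i u where p: "awalk u p u" "p \<noteq> []"
      and i: "\<forall>e \<in> set p. c (fst e) = i \<and> c (snd e) = i"
      by (auto simp: cycle_def monochromatic_def)
    have "set p \<subseteq> colour_arcs G c i"
      using p i by (auto simp: colour_arcs_def awalk_def)
    then have "(u, u) \<in> (colour_arcs G c i)\<^sup>+" using awalk_imp_trancl p by blast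
    then show "\<exists>i. \<not> acyclic (colour_arcs G c i)" by (auto simp: acyclic_def)
  next
    assume "\<exists>i. \<not> acyclic (colour_arcs G c i)"
    then obtain i u where u: "(u, u) \<in> (colour_arcs G c i)\<^sup>+" by (auto simp: acyclic_def)
    \<comment> \<open>Extracting the cycle inside the digraph of one colour class keeps it
      monochromatic.\<close>
    define H where "H = \<lparr>pverts = pverts G, parcs = colour_arcs G c i\<rparr>"
    interpret H: pair_wf_digraph H
      by unfold_locales (auto simp: H_def colour_arcs_def dest: in_arcsD1 in_arcsD2)
    obtain p where "H.awalk u p u" "p \<noteq> []"
      using H.trancl_imp_closed_walk u by (auto simp: H_def)
    then obtain q where q: "H.cycle q"
      using H.closed_w_imp_cycle by (auto simp: H.closed_w_def)
    have "subgraph (with_proj H) (with_proj G)"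
      unfolding subgraph_def using H.wf_digraph_axioms wf_digraph_axioms
      by (auto simp: H_def colour_arcs_def)
    then have "cycle q" using q by (rule subgraph_cycle)
    moreover have "monochromatic c q"
      using q unfolding H.cycle_def H.awalk_def monochromatic_def
      by (fastforce simp: H_def colour_arcs_def)
    ultimately show "\<exists>p. cycle p \<and> monochromatic c p" by blast
  qed
  then show ?thesis by (auto simp: dicolouring_def)
qed

section \<open>Degree bound, blocked recolourings and existence of a 2-dicolouring\<close>

locale subcubic_oriented_graph = oriented_graph +
  assumes subcubic: "subcubic G"
begin

definition nbr :: "'a \<Rightarrow> 'a \<Rightarrow> bool" where
  "nbr v w \<longleftrightarrow> (v, w) \<in> parcs G \<or> (w, v) \<in> parcs G"

text \<open>The degree bound in the form that the counting arguments use: once three distinct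
  neighbours of \<open>v\<close> are known, any further neighbour is one of them.\<close>

lemma no_four_nbrs:
  assumes "nbr v a" "nbr v b" "nbr v c" "nbr v d"
  shows "a = b \<or> a = c \<or> a = d \<or> b = c \<or> b = d \<or> c = d"
proof (rule ccontr)
  assume neq: "\<not> ?thesis"
  let ?S = "out_arcs (mk_symmetric G) v"
  have "v \<in> pverts G" using assms(1) by (auto simp: nbr_def dest: in_arcsD1 in_arcsD2)
  then have "card ?S \<le> 3"
    using subcubic by (auto simp: subcubic_def out_degree_def)
  moreover have "finite ?S"
    by (rule finite_subset[of _ "parcs G \<union> (parcs G)\<inverse>"])
      (auto simp: out_arcs_def parcs_mk_symmetric pair_finite_arcs)
  moreover have "Pair v ` {a, b, c, d} \<subseteq> ?S"
  proof -
    have "(v, w) \<in> ?S" if "nbr v w" for w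
    proof -
      have "(v, w) \<in> parcs (mk_symmetric G)"
        using that unfolding nbr_def parcs_mk_symmetric with_proj_simps
        by (elim disjE) (rule UN_I, assumption, simp)+
      then show ?thesis by (simp add: out_arcs_def)
    qed
    then show ?thesis using assms by auto
  qed
  ultimately have "card (Pair v ` {a, b, c, d}) \<le> 3"
    by (meson card_mono le_trans)
  moreover have "card (Pair v ` {a, b, c, d}) = 4"
    using neq by (subst card_image) (auto simp: inj_on_def)
  ultimately show False by simp
qed

abbreviation dic :: "('a \<Rightarrow> nat) \<Rightarrow> bool" where
  "dic \<equiv> dicolouring 2 G"

lemma dic_values: "dic c \<Longrightarrow> v \<in> pverts G \<Longrightarrow> c v = 1 \<or> c v = 2"
  by (fastforce simp: dicolouring_iff PiE_iff)

text \<open>Since \<open>c\<close> has no monochromatic cycle, the new one passes through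
  \<open>v\<close>; the rest of it was already monochromatic under \<open>c\<close>.\<close>

lemma blocked:
  assumes "dic c" "v \<in> pverts G" "k \<in> {1..2}" "\<not> dic (c(v := k))"
  shows "\<exists>x y. (x, v) \<in> parcs G \<and> (v, y) \<in> parcs G \<and> c x = k \<and> c y = k \<and>
    (y, x) \<in> (colour_arcs G c k)\<^sup>*"
proof -
  let ?d = "c(v := k)"
  have d: "?d \<in> pverts G \<rightarrow>\<^sub>E {1..2}"
    using assms by (auto simp: dicolouring_iff PiE_iff extensional_def)
  then obtain i where i: "\<not> acyclic (colour_arcs G ?d i)"
    using assms by (auto simp: dicolouring_iff)
  have ac: "acyclic (colour_arcs G c i)" using assms by (auto simp: dicolouring_iff)
  have "colour_arcs G ?d i \<subseteq> colour_arcs G c i \<union> {v} \<times> UNIV \<union> UNIV \<times> {v}"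
    by (auto simp: colour_arcs_def split: if_splits)
  from cycle_through_new_vertex[OF ac this i] obtain x y
    where *: "(x, v) \<in> colour_arcs G ?d i" "(v, y) \<in> colour_arcs G ?d i"
      "(y, x) \<in> (colour_arcs G c i)\<^sup>*"
    by blast
  then have "i = k" "(x, v) \<in> parcs G" "(v, y) \<in> parcs G"
    by (auto simp: colour_arcs_def)
  \<comment> \<open>A loop would be its own opposite arc.\<close>
  moreover have "x \<noteq> v" "y \<noteq> v"
    using calculation no_opposite_arcs by blast+
  ultimately show ?thesis using * by (auto simp: colour_arcs_def)
qed

text \<open>Colour the vertices one at a time, giving each a colour that does not occur both on an
  in-neighbour and on an out-neighbour; then it closes no monochromatic cycle.\<close>

lemma dicolouring_exists: "\<exists>c. dic c"
proof -
  have "\<exists>c \<in> pverts G \<rightarrow>\<^sub>E {1..2}. \<forall>i. acyclic (colour_arcs G c i \<inter> S \<times> S)"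
    if "finite S" "S \<subseteq> pverts G" for S
    using that
  proof (induction S rule: finite_induct)
    case empty
    have "restrict (\<lambda>_. 1) (pverts G) \<in> pverts G \<rightarrow>\<^sub>E {1..2::nat}" by auto
    then show ?case by (intro bexI[where x = "restrict (\<lambda>_. 1) (pverts G)"]) (auto simp: acyclic_def)
  next
    case (insert v S)
    then obtain c where c: "c \<in> pverts G \<rightarrow>\<^sub>E {1..2}"
      and ac: "\<And>i. acyclic (colour_arcs G c i \<inter> S \<times> S)"
      by blast
    have v: "v \<in> pverts G" using insert by simp
    obtain k where k: "k \<in> {1..2}"
      and free: "\<And>x y. (x, v) \<in> parcs G \<Longrightarrow> (v, y) \<in> parcs G \<Longrightarrow> c x = k \<Longrightarrow> c y = k \<Longrightarrow> False"
    proof (rule ccontr)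
      assume "\<not> thesis"
      then have "\<forall>k \<in> {1..2}. \<exists>x y. (x, v) \<in> parcs G \<and> (v, y) \<in> parcs G \<and> c x = k \<and> c y = k"
        using that by metis
      then have "\<exists>x y. (x, v) \<in> parcs G \<and> (v, y) \<in> parcs G \<and> c x = 1 \<and> c y = 1"
        "\<exists>x y. (x, v) \<in> parcs G \<and> (v, y) \<in> parcs G \<and> c x = 2 \<and> c y = 2"
        by simp_all
      then obtain a b x y where
        "(a, v) \<in> parcs G" "(v, b) \<in> parcs G" "c a = 1" "c b = 1"
        "(x, v) \<in> parcs G" "(v, y) \<in> parcs G" "c x = 2" "c y = 2"
        by blast
      \<comment> \<open>Colours separate \<open>a\<close>, \<open>b\<close> from \<open>x\<close>,
        \<open>y\<close>, and equality within either pair would give opposite arcs, so these are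
        four distinct neighbours.\<close>
      then show False
        using no_four_nbrs[of v a b x y]
        by (auto simp: nbr_def dest: no_opposite_arcs)
    qed
    let ?d = "c(v := k)"
    have "acyclic (colour_arcs G ?d i \<inter> insert v S \<times> insert v S)" for i
    proof (rule ccontr)
      assume "\<not> ?thesis"
      moreover have "colour_arcs G ?d i \<inter> insert v S \<times> insert v S
          \<subseteq> colour_arcs G c i \<inter> S \<times> S \<union> {v} \<times> UNIV \<union> UNIV \<times> {v}"
        by (auto simp: colour_arcs_def split: if_splits)
      ultimately obtain x y where *: "(x, v) \<in> colour_arcs G ?d i" "(v, y) \<in> colour_arcs G ?d i"
        using cycle_through_new_vertex[OF ac[of i]] by blast
      then have "x \<noteq> v" "y \<noteq> v" using no_opposite_arcs by (auto simp: colour_arcs_def)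
      then show False using * free[of x y] by (auto simp: colour_arcs_def)
    qed
    moreover have "?d \<in> pverts G \<rightarrow>\<^sub>E {1..2}"
      using c v k by (auto simp: PiE_iff extensional_def)
    ultimately show ?case by blast
  qed
  from this[OF pair_finite_verts subset_refl] obtain c where
    c: "c \<in> pverts G \<rightarrow>\<^sub>E {1..2}" "\<And>i. acyclic (colour_arcs G c i \<inter> pverts G \<times> pverts G)"
    by blast
  have "colour_arcs G c i \<inter> pverts G \<times> pverts G = colour_arcs G c i" for i
    by (auto simp: colour_arcs_def dest: in_arcsD1 in_arcsD2)
  with c show ?thesis by (auto simp: dicolouring_iff)
qed

section \<open>Stuck pairs: no differing vertex can take its final colour directly\<close>

context
  fixes \<alpha> \<beta> :: "'a \<Rightarrow> nat"
  assumes \<alpha>: "dic \<alpha>" and \<beta>: "dic \<beta>"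
    and stuck: "\<And>v. v \<in> pverts G \<Longrightarrow> \<alpha> v \<noteq> \<beta> v \<Longrightarrow> \<not> dic (\<alpha>(v := \<beta> v))"
begin

lemma stuck_blocked:
  assumes "v \<in> pverts G" "\<alpha> v \<noteq> \<beta> v"
  shows "\<exists>x y. (x, v) \<in> parcs G \<and> (v, y) \<in> parcs G \<and> \<alpha> x = \<beta> v \<and> \<alpha> y = \<beta> v \<and>
    (y, x) \<in> (colour_arcs G \<alpha> (\<beta> v))\<^sup>*"
  using blocked[OF \<alpha> assms(1) _ stuck[OF assms]] dic_values[OF \<beta> assms(1)] by auto

text \<open>
  Some vertex \<open>u\<close> of the cycle blocking \<open>v\<close> also changes colour. Being blocked itself, \<open>u\<close> has
  two neighbours of the colour of \<open>v\<close>, hence at most one neighbour of its own colour.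
\<close>

lemma stuck_arc:
  assumes "v0 \<in> pverts G" "\<alpha> v0 \<noteq> \<beta> v0"
  shows "\<exists>v u x. (v, u) \<in> parcs G \<and> (x, v) \<in> parcs G \<and> \<alpha> v \<noteq> \<beta> v \<and> \<alpha> u \<noteq> \<beta> u \<and>
    \<alpha> v \<noteq> \<alpha> u \<and> \<alpha> x = \<alpha> u \<and> (u, x) \<in> (colour_arcs G \<alpha> (\<alpha> u))\<^sup>*"
proof -
  define j where "j = \<beta> v0"
  obtain x y where xy: "(x, v0) \<in> parcs G" "(v0, y) \<in> parcs G" "\<alpha> x = j" "\<alpha> y = j"
    "(y, x) \<in> (colour_arcs G \<alpha> j)\<^sup>*"
    using stuck_blocked[OF assms] by (auto simp: j_def)
  \<comment> \<open>Otherwise \<open>\<beta>\<close> gives colour \<open>j\<close> to a whole path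
    from \<open>y\<close> to \<open>x\<close>, which closes to a monochromatic cycle of
    \<open>\<beta>\<close> through \<open>v0\<close>, as \<open>\<beta> v0 = j\<close>.\<close>
  have "\<exists>u. (y, u) \<in> (colour_arcs G \<alpha> j)\<^sup>* \<and> (u, x) \<in> (colour_arcs G \<alpha> j)\<^sup>* \<and> \<beta> u \<noteq> j"
  proof (rule ccontr)
    assume "\<not> ?thesis"
    then have *: "\<beta> u = j" if "(y, u) \<in> (colour_arcs G \<alpha> j)\<^sup>*" "(u, x) \<in> (colour_arcs G \<alpha> j)\<^sup>*" for u
      using that by blast
    have "(y, x) \<in> (colour_arcs G \<alpha> j \<inter> {(a, b). \<beta> a = j \<and> \<beta> b = j})\<^sup>*"
      using rtrancl_restrict_to_path[OF xy(5), of "\<lambda>u. \<beta> u = j"] * by blast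
    then have "(y, x) \<in> (colour_arcs G \<beta> j)\<^sup>*"
      by (rule rtrancl_mono[THEN subsetD, rotated]) (auto simp: colour_arcs_def)
    moreover have "\<beta> x = j" "\<beta> y = j" using * xy(5) by auto
    then have "(x, v0) \<in> colour_arcs G \<beta> j" "(v0, y) \<in> colour_arcs G \<beta> j"
      using xy by (auto simp: colour_arcs_def j_def)
    ultimately have "(x, x) \<in> (colour_arcs G \<beta> j)\<^sup>+"
      by (meson converse_rtrancl_into_rtrancl rtrancl_into_trancl2)
    then show False using \<beta> by (auto simp: dicolouring_iff acyclic_def)
  qed
  then obtain u where yu: "(y, u) \<in> (colour_arcs G \<alpha> j)\<^sup>*" and ux: "(u, x) \<in> (colour_arcs G \<alpha> j)\<^sup>*"
    and bu: "\<beta> u \<noteq> j" by blast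
  have au: "\<alpha> u = j" using yu xy(4) by (cases rule: rtranclE) (auto simp: colour_arcs_def)
  have uV: "u \<in> pverts G"
    using yu xy(2) by (cases rule: rtranclE) (auto simp: colour_arcs_def dest: in_arcsD2)
  define i where "i = \<alpha> v0"
  have ij: "i \<noteq> j" "\<beta> u = i"
    using dic_values[OF \<alpha> assms(1)] dic_values[OF \<beta> assms(1)] dic_values[OF \<beta> uV] assms(2) bu
    by (auto simp: i_def j_def)
  obtain p q where pq: "(p, u) \<in> parcs G" "(u, q) \<in> parcs G" "\<alpha> p = i" "\<alpha> q = i"
    "(q, p) \<in> (colour_arcs G \<alpha> i)\<^sup>*"
    using stuck_blocked[OF uV] au ij by auto
  have "p \<noteq> q" using pq no_opposite_arcs by blast
  \<comment> \<open>With \<open>p\<close> and \<open>q\<close> in colour \<open>i\<close>, an inner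
    vertex of the path would have four neighbours, so \<open>u\<close> is \<open>y\<close> or
    \<open>x\<close>.\<close>
  have pred: "\<exists>w. (w, u) \<in> parcs G \<and> \<alpha> w = j" if "u \<noteq> y"
    using yu that by (cases rule: rtranclE) (auto simp: colour_arcs_def)
  have succ: "\<exists>w. (u, w) \<in> parcs G \<and> \<alpha> w = j" if "u \<noteq> x"
    using ux that by (cases rule: converse_rtranclE) (auto simp: colour_arcs_def)
  have "x \<noteq> y" using xy no_opposite_arcs by blast
  show ?thesis
  proof (cases "u = y")
    case True
    then show ?thesis
      using xy assms(2) au ij bu i_def by (intro exI[of _ v0] exI[of _ u] exI[of _ x]) auto
  next
    case False
    then obtain w where w: "(w, u) \<in> parcs G" "\<alpha> w = j" using pred by blast
    have "u = x"
    proof (rule ccontr)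
      assume "u \<noteq> x"
      then obtain w' where "(u, w') \<in> parcs G" "\<alpha> w' = j" using succ by blast
      then show False
        using no_four_nbrs[of u p q w w'] pq w ij \<open>p \<noteq> q\<close>
        by (auto simp: nbr_def dest: no_opposite_arcs)
    qed
    \<comment> \<open>Since \<open>u = x\<close>, \<open>v0\<close> too is an out-neighbour of
      \<open>u\<close> in colour \<open>i\<close>. So the cycle blocking \<open>u\<close> runs
      through \<open>v0\<close>, and \<open>u\<close>, \<open>v0\<close>, \<open>p\<close> can take
      the roles of \<open>v\<close>, \<open>u\<close>, \<open>x\<close> in the claim.\<close>
    have "v0 = q"
      using no_four_nbrs[of u p q w v0] pq w ij \<open>p \<noteq> q\<close> xy \<open>u = x\<close> i_def
      by (auto simp: nbr_def dest: no_opposite_arcs)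
    have "\<alpha> u \<noteq> \<beta> u" "\<alpha> v0 = i" "\<alpha> u \<noteq> \<alpha> v0" "(u, v0) \<in> parcs G"
      using au ij i_def xy(1) \<open>u = x\<close> by simp_all
    moreover have "(v0, p) \<in> (colour_arcs G \<alpha> i)\<^sup>*" using pq(5) \<open>v0 = q\<close> by simp
    ultimately show ?thesis using pq(1,3) assms(2) by metis
  qed
qed

text \<open>
  For the arc \<open>vu\<close> of \<open>stuck_arc\<close>, \<open>u\<close> is the only out-neighbour of \<open>v\<close> and \<open>v\<close> the only in-neighbour
  of \<open>u\<close>. So a monochromatic cycle through \<open>v\<close> or \<open>u\<close> needs \<open>v\<close> and \<open>u\<close> to have the same colour, and
  \<open>x\<close> can be recoloured as long as they differ.
\<close>

lemma stuck_swap: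
  assumes "v0 \<in> pverts G" "\<alpha> v0 \<noteq> \<beta> v0"
  obtains v u x where "v \<in> pverts G" "u \<in> pverts G" "x \<in> pverts G"
    "\<alpha> v \<noteq> \<beta> v" "\<alpha> u \<noteq> \<beta> u" "u \<noteq> v" "x \<noteq> u" "x \<noteq> v" "\<alpha> x \<noteq> \<alpha> v"
    "dic (\<alpha>(x := \<alpha> v))" "dic (\<alpha>(x := \<alpha> v, v := \<beta> v))"
    "dic (\<alpha>(x := \<alpha> v, v := \<beta> v, u := \<beta> u))" "dic (\<alpha>(v := \<beta> v, u := \<beta> u))"
proof -
  obtain v u x where vu: "(v, u) \<in> parcs G" and xv: "(x, v) \<in> parcs G"
    and diff: "\<alpha> v \<noteq> \<beta> v" "\<alpha> u \<noteq> \<beta> u" "\<alpha> v \<noteq> \<alpha> u" and ax: "\<alpha> x = \<alpha> u"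
    and ux: "(u, x) \<in> (colour_arcs G \<alpha> (\<alpha> u))\<^sup>*"
    using stuck_arc[OF assms] by blast
  have V: "v \<in> pverts G" "u \<in> pverts G" "x \<in> pverts G"
    using vu xv by (auto dest: in_arcsD1 in_arcsD2)
  define i j where "i = \<alpha> v" and "j = \<alpha> u"
  have ij: "i \<noteq> j" "\<beta> v = j" "\<beta> u = i" "i \<in> {1..2}" "j \<in> {1..2}"
    using dic_values[OF \<alpha> V(1)] dic_values[OF \<alpha> V(2)] dic_values[OF \<beta> V(1)]
      dic_values[OF \<beta> V(2)] diff by (auto simp: i_def j_def)
  have ne: "x \<noteq> u" "x \<noteq> v" "u \<noteq> v"
    using vu xv no_opposite_arcs diff ax by auto
  \<comment> \<open>\<open>w\<close> follows \<open>u\<close> and \<open>t\<close> precedes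
    \<open>x\<close> on the path from \<open>u\<close> to \<open>x\<close>; both exist because
    \<open>x \<noteq> u\<close>.\<close>
  obtain w where w: "(u, w) \<in> parcs G" "\<alpha> w = j"
    using ux ne by (cases rule: converse_rtranclE) (auto simp: colour_arcs_def j_def)
  obtain t where t: "(t, x) \<in> parcs G" "\<alpha> t = j"
    using ux ne by (cases rule: rtranclE) (auto simp: colour_arcs_def j_def)
  obtain p q where pq: "(p, u) \<in> parcs G" "(u, q) \<in> parcs G" "\<alpha> p = i" "\<alpha> q = i"
    "(q, p) \<in> (colour_arcs G \<alpha> i)\<^sup>*"
    using stuck_blocked[OF V(2) diff(2)] ij by auto
  have "p \<noteq> q" "v \<noteq> q" using pq vu no_opposite_arcs by blast+
  \<comment> \<open>\<open>v\<close>, \<open>w\<close> and \<open>q\<close> are all the neighbours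
    of \<open>u\<close>, and the last two are out-neighbours.\<close>
  have in_u: "a = v" if "(a, u) \<in> parcs G" for a
    using no_four_nbrs[of u a v w q] that vu w pq ij \<open>v \<noteq> q\<close> i_def
    by (auto simp: nbr_def dest: no_opposite_arcs)
  have "p = v" using pq in_u by blast
  \<comment> \<open>As \<open>p = v\<close>, the cycle blocking \<open>u\<close> enters
    \<open>v\<close> from a vertex of colour \<open>i\<close>. Then \<open>x\<close>,
    \<open>s\<close> and \<open>u\<close> are all the neighbours of \<open>v\<close>.\<close>
  obtain s where s: "(s, v) \<in> parcs G" "\<alpha> s = i"
    using pq(5) \<open>p = v\<close> \<open>p \<noteq> q\<close> by (cases rule: rtranclE) (auto simp: colour_arcs_def)
  have in_v: "a = x \<or> a = s" if "(a, v) \<in> parcs G" for a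
    using no_four_nbrs[of v a x s u] that vu xv s ax ij j_def
    by (auto simp: nbr_def dest: no_opposite_arcs)
  have out_v: "a = u" if "(v, a) \<in> parcs G" for a
    using no_four_nbrs[of v a x s u] that vu xv s ax ij j_def
    by (auto simp: nbr_def dest: no_opposite_arcs)
  let ?a1 = "\<alpha>(x := i)"
  have d1: "dic ?a1"
  proof (rule ccontr)
    assume "\<not> dic ?a1"
    from blocked[OF \<alpha> V(3) ij(4) this] obtain a b
      where ab: "(a, x) \<in> parcs G" "(x, b) \<in> parcs G" "\<alpha> a = i" "\<alpha> b = i"
        "(b, a) \<in> (colour_arcs G \<alpha> i)\<^sup>*"
      by blast
    have "a \<noteq> b" using ab no_opposite_arcs by blast
    \<comment> \<open>\<open>a\<close>, \<open>b\<close> and \<open>t\<close> exhaust the neighbours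
      of \<open>x\<close>, and \<open>v\<close> is an out-neighbour of colour \<open>i\<close>. The
      path from \<open>b\<close> to \<open>a\<close> would then have to leave \<open>v\<close>
      through \<open>u\<close>, which has colour \<open>j\<close>.\<close>
    have "v = b"
      using no_four_nbrs[of x a b t v] ab t xv ij i_def \<open>a \<noteq> b\<close>
      by (auto simp: nbr_def dest: no_opposite_arcs)
    show False
      using ab(5) \<open>a \<noteq> b\<close> \<open>v = b\<close> out_v ij j_def
      by (cases rule: converse_rtranclE) (auto simp: colour_arcs_def)
  qed
  let ?a2 = "?a1(v := j)"
  have d2: "dic ?a2"
  proof (rule ccontr)
    assume "\<not> dic ?a2"
    from blocked[OF d1 V(1) ij(5) this] obtain a where "(a, v) \<in> parcs G" "?a1 a = j"
      by blast
    \<comment> \<open>After \<open>x\<close> is recoloured, both in-neighbours \<open>x\<close> and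
      \<open>s\<close> of \<open>v\<close> have colour \<open>i\<close>.\<close>
    then show False using in_v[of a] s ij by (auto split: if_splits)
  qed
  let ?a3 = "?a2(u := i)"
  have d3: "dic ?a3"
  proof (rule ccontr)
    assume "\<not> dic ?a3"
    from blocked[OF d2 V(2) ij(4) this] obtain a where "(a, u) \<in> parcs G" "?a2 a = i"
      by blast
    then show False using in_u[of a] ij by auto
  qed
  \<comment> \<open>A blocking path in colour \<open>j\<close> cannot leave \<open>v\<close>, whose
    only out-neighbour \<open>u\<close> now has colour \<open>i\<close>, nor end there, as
    \<open>v\<close> is an out-neighbour of \<open>x\<close>. Away from \<open>v\<close>, colour
    \<open>j\<close> in \<open>?a3\<close> is inherited from \<open>\<alpha>\<close>, so
    \<open>\<alpha>\<close> would already have the cycle.\<close>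
  have d4: "dic (?a3(x := j))"
  proof (rule ccontr)
    assume "\<not> dic (?a3(x := j))"
    from blocked[OF d3 V(3) ij(5) this] obtain a b
      where ab: "(a, x) \<in> parcs G" "(x, b) \<in> parcs G" "?a3 a = j" "?a3 b = j"
        "(b, a) \<in> (colour_arcs G ?a3 j)\<^sup>*"
      by blast
    have av: "a \<noteq> v" using ab xv no_opposite_arcs by blast
    have keep: "\<alpha> c = j" if "?a3 c = j" "c \<noteq> v" for c
      using that ij by (auto split: if_splits)
    from ab(5) have "b \<noteq> v \<and> (b, a) \<in> (colour_arcs G \<alpha> j)\<^sup>*"
    proof (induction rule: converse_rtrancl_induct)
      case base
      then show ?case using av by simp
    next
      case (step y z)
      have yz: "(y, z) \<in> parcs G" "?a3 y = j" "?a3 z = j"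
        using step.hyps by (auto simp: colour_arcs_def)
      then have "y \<noteq> v" using out_v[of z] ij by auto
      then have "(y, z) \<in> colour_arcs G \<alpha> j"
        using yz keep step.IH by (auto simp: colour_arcs_def)
      then show ?case using step.IH \<open>y \<noteq> v\<close> by (meson converse_rtrancl_into_rtrancl)
    qed
    moreover from this have "\<alpha> a = j" "\<alpha> b = j" using keep av ab(3,4) by blast+
    then have "(a, x) \<in> colour_arcs G \<alpha> j" "(x, b) \<in> colour_arcs G \<alpha> j"
      using ab(1,2) ax by (simp_all add: colour_arcs_def j_def)
    ultimately have "(a, a) \<in> (colour_arcs G \<alpha> j)\<^sup>+"
      by (meson converse_rtrancl_into_rtrancl rtrancl_into_trancl2)
    then show False using \<alpha> by (auto simp: dicolouring_iff acyclic_def)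
  qed
  have "?a3(x := j) = \<alpha>(v := \<beta> v, u := \<beta> u)"
    using ne ij ax by (auto simp: fun_eq_iff j_def)
  then show thesis
    using that[OF V diff(1,2) ne(3,1,2)] d1 d2 d3 d4 diff ax ij by (simp add: i_def)
qed

end

section \<open>Short walks in the dicolouring graph\<close>

abbreviation D :: "('a \<Rightarrow> nat) pair_pre_digraph" where
  "D \<equiv> dicolouring_graph 2 G"

sublocale D: pair_bidirected_digraph D
  by (rule pair_bidirected_digraph_dicolouring_graph)

lemma in_pverts_D: "c \<in> pverts D \<longleftrightarrow> dic c"
  by (simp add: dicolouring_graph_def)

lemma recolour_arc:
  assumes "dic c" "dic (c(v := k))" "v \<in> pverts G" "c v \<noteq> k"
  shows "(c, c(v := k)) \<in> parcs D"
  using assms by (auto simp: dicolouring_graph_def)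

lemma recolour_awalk:
  assumes "dic c" "dic (c(v := k))" "v \<in> pverts G" "c v \<noteq> k" "D.awalk (c(v := k)) p d"
  shows "D.awalk c ((c, c(v := k)) # p) d"
  using assms recolour_arc by (simp add: D.awalk_Cons_iff)

text \<open>Induction on the number of differing vertices with the target fixed. Each kind of move
  spends at most two steps per vertex removed, whence the factor 2.\<close>

lemma short_awalk:
  assumes "dic \<alpha>" "dic \<beta>"
  shows "\<exists>p. D.awalk \<alpha> p \<beta> \<and> length p \<le> 2 * card {v \<in> pverts G. \<alpha> v \<noteq> \<beta> v}"
  using assms
proof (induction "card {v \<in> pverts G. \<alpha> v \<noteq> \<beta> v}" arbitrary: \<alpha> rule: less_induct)
  case less
  let ?X = "\<lambda>c. {v \<in> pverts G. c v \<noteq> \<beta> v}"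
  have fin: "finite (?X c)" for c using pair_finite_verts by simp
  consider "?X \<alpha> = {}"
    | v where "v \<in> ?X \<alpha>" "dic (\<alpha>(v := \<beta> v))"
    | v where "v \<in> ?X \<alpha>" "\<And>v. v \<in> pverts G \<Longrightarrow> \<alpha> v \<noteq> \<beta> v \<Longrightarrow> \<not> dic (\<alpha>(v := \<beta> v))"
    by blast
  then show ?case
  proof cases
    case 1
    then have "\<alpha> = \<beta>"
      using less.prems by (auto simp: dicolouring_def intro: PiE_ext)
    then have "D.awalk \<alpha> [] \<beta>" using less.prems by (simp add: D.awalk_Nil_iff in_pverts_D)
    then show ?thesis by (intro exI[of _ "[]"]) simp
  next
    case (2 v)
    have X: "?X (\<alpha>(v := \<beta> v)) = ?X \<alpha> - {v}" by auto
    have card: "card (?X (\<alpha>(v := \<beta> v))) + 1 = card (?X \<alpha>)"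
      unfolding X using card_Suc_Diff1[OF fin 2(1)] by simp
    then have less_card: "card (?X (\<alpha>(v := \<beta> v))) < card (?X \<alpha>)" by simp
    obtain p where
      p: "D.awalk (\<alpha>(v := \<beta> v)) p \<beta>" "length p \<le> 2 * card (?X (\<alpha>(v := \<beta> v)))"
      using less.hyps[OF less_card 2(2) less.prems(2)] by blast
    have "D.awalk \<alpha> ((\<alpha>, \<alpha>(v := \<beta> v)) # p) \<beta>"
      by (rule recolour_awalk) (use less.prems(1) 2 p(1) in simp_all)
    moreover have "length ((\<alpha>, \<alpha>(v := \<beta> v)) # p) \<le> 2 * card (?X \<alpha>)"
      using p(2) card by simp
    ultimately show ?thesis by blast
  next
    case (3 v0)
    then have v0: "v0 \<in> pverts G" "\<alpha> v0 \<noteq> \<beta> v0" by auto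
    obtain v u x where V: "v \<in> pverts G" "u \<in> pverts G" "x \<in> pverts G"
      and diff: "\<alpha> v \<noteq> \<beta> v" "\<alpha> u \<noteq> \<beta> u"
      and ne: "u \<noteq> v" "x \<noteq> u" "x \<noteq> v" and ax: "\<alpha> x \<noteq> \<alpha> v"
      and d1: "dic (\<alpha>(x := \<alpha> v))" and d2: "dic (\<alpha>(x := \<alpha> v, v := \<beta> v))"
      and d3: "dic (\<alpha>(x := \<alpha> v, v := \<beta> v, u := \<beta> u))" and d4: "dic (\<alpha>(v := \<beta> v, u := \<beta> u))"
      using stuck_swap[OF less.prems 3(2) v0] by blast
    let ?a1 = "\<alpha>(x := \<alpha> v)"
    let ?a2 = "?a1(v := \<beta> v)"
    let ?a3 = "?a2(u := \<beta> u)"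
    let ?a4 = "\<alpha>(v := \<beta> v, u := \<beta> u)"
    \<comment> \<open>\<open>x\<close> gets its initial colour back, so its membership in the
      difference set is unchanged and only \<open>v\<close> and \<open>u\<close> leave that
      set.\<close>
    have a4: "?a4 = ?a3(x := \<alpha> x)" using ne by (auto simp: fun_eq_iff)
    have X: "?X ?a4 = ?X \<alpha> - {v, u}" by auto
    have "card (?X \<alpha> - {v, u}) = card (?X \<alpha>) - card {v, u}"
      by (rule card_Diff_subset) (use V diff in auto)
    moreover have "card {v, u} \<le> card (?X \<alpha>)"
      by (rule card_mono) (use V diff fin in auto)
    ultimately have card: "card (?X ?a4) + 2 = card (?X \<alpha>)"
      unfolding X using ne by simp
    then have less_card: "card (?X ?a4) < card (?X \<alpha>)" by simp
    obtain p where
      p: "D.awalk ?a4 p \<beta>" "length p \<le> 2 * card (?X ?a4)"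
      using less.hyps[OF less_card d4 less.prems(2)] by blast
    have "D.awalk ?a3 ((?a3, ?a4) # p) \<beta>"
      using recolour_awalk[OF d3, of x "\<alpha> x" p \<beta>] d4 p(1) V(3) ne ax
      unfolding a4[symmetric] by simp
    then have "D.awalk ?a2 ((?a2, ?a3) # (?a3, ?a4) # p) \<beta>"
      by (rule recolour_awalk[rotated -1]) (use d2 d3 V ne diff in auto)
    then have "D.awalk ?a1 ((?a1, ?a2) # (?a2, ?a3) # (?a3, ?a4) # p) \<beta>"
      by (rule recolour_awalk[rotated -1]) (use d1 d2 V ne diff in auto)
    then have "D.awalk \<alpha> ((\<alpha>, ?a1) # (?a1, ?a2) # (?a2, ?a3) # (?a3, ?a4) # p) \<beta>"
      by (rule recolour_awalk[rotated -1]) (use d1 less.prems V ne ax in auto)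
    moreover have "length ((\<alpha>, ?a1) # (?a1, ?a2) # (?a2, ?a3) # (?a3, ?a4) # p) \<le> 2 * card (?X \<alpha>)"
      using p(2) card by simp
    ultimately show ?thesis by blast
  qed
qed

lemma dist_bound:
  assumes "dic \<alpha>" "dic \<beta>"
  shows "\<exists>p. D.awalk \<alpha> p \<beta> \<and> length p \<le> 2 * card (pverts G)"
proof -
  have "card {v \<in> pverts G. \<alpha> v \<noteq> \<beta> v} \<le> card (pverts G)"
    by (rule card_mono) (use pair_finite_verts in auto)
  then show ?thesis using short_awalk[OF assms] by fastforce
qed

lemma connected_dicolouring_graph: "Digraph_Component.connected D"
  unfolding connected_def
proof (rule strongly_connectedI)
  \<comment> \<open>Connectedness includes having a vertex, which is why existence of a dicolouring
    was proved.\<close>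
  show "verts (mk_symmetric D) \<noteq> {}"
    using dicolouring_exists by (auto simp: dicolouring_graph_def)
  fix c d assume "c \<in> verts (mk_symmetric D)" "d \<in> verts (mk_symmetric D)"
  then have "dic c" "dic d" by (auto simp: dicolouring_graph_def)
  then obtain p where "D.awalk c p d" using dist_bound by blast
  then have "c \<rightarrow>\<^sup>*\<^bsub>D\<^esub> d" by (auto simp: D.reachable_awalk)
  then show "c \<rightarrow>\<^sup>*\<^bsub>mk_symmetric D\<^esub> d" by (rule D.reachable_mk_symmetricI)
qed

lemma diameter_dicolouring_graph: "diameter D \<le> ereal (real (2 * card (pverts G)))"
  unfolding diameter_def
proof (rule SUP_least, clarify)
  fix c d assume "c \<in> verts D" "d \<in> verts D"
  then have "dic c" "dic d" by (auto simp: dicolouring_graph_def)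
  then obtain p where p: "D.awalk c p d" "length p \<le> 2 * card (pverts G)"
    using dist_bound by blast
  have "D.\<mu> (\<lambda>_. 1) c d \<le> D.awalk_cost (\<lambda>_. 1) p"
    using p(1) by (rule D.min_cost_le_walk_cost)
  also have "D.awalk_cost (\<lambda>_. 1) p = real (length p)"
    by (induction p) (auto simp: D.awalk_cost_def)
  also have "ereal (real (length p)) \<le> ereal (real (2 * card (pverts G)))"
    using p(2) by (simp only: ereal_less_eq of_nat_le_iff)
  finally show "D.\<mu> (\<lambda>_. 1) c d \<le> ereal (real (2 * card (pverts G)))" .
qed

end

theorem theorem11:
  fixes G :: "'a pair_pre_digraph" and n :: nat
  assumes "oriented_graph G"
    and "subcubic G"
    and "card (pverts G) = n"
  shows "Digraph_Component.connected (dicolouring_graph 2 G) \<and>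
         diameter (dicolouring_graph 2 G) \<le> ereal (real (2 * n))"
proof -
  interpret subcubic_oriented_graph G
    using assms by (simp add: subcubic_oriented_graph_def subcubic_oriented_graph_axioms_def)
  show ?thesis
    using connected_dicolouring_graph diameter_dicolouring_graph assms(3) by simp
qed

end
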